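(* Let $(Z,d_Z)$ be a complete metric space with at least three points, and let $\omega\in\partial_G\mathrm{Con}_h(Z)$ be the point of the Gromov boundary of $(\mathrm{Con}_h(Z),\rho_h)$ whose equivalence class contains every sequence $\{(z_n,h_n)\}$ in $\mathrm{Con}_h(Z)$ with $\lim_{n\to\infty}h_n=\infty$. Then $\partial_\omega\mathrm{Con}_h(Z)$ and $Z$ can be identified as sets, and $d_Z$ induces a visual metric $d$ on $\partial_\omega\mathrm{Con}_h(Z)$ based at $\omega$ with parameter $1$; that is, there is a bijection $\psi:Z\to\partial_\omega\mathrm{Con}_h(Z)$ such that the metric $d$ defined by $d(\psi(z_1),\psi(z_2))=d_Z(z_1,z_2)$ for $z_1,z_2\in Z$ is a visual metric on $\partial_\omega\mathrm{Con}_h(Z)$ based at $\omega$ with parameter $1$.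
   Context: Infinite hyperbolic cone: $\mathrm{Con}_h(Z)=Z\times(0,\infty)$ with the metric $\rho_h((x,s),(y,t))=2\log\left(\frac{d_Z(x,y)+\max\{s,t\}}{\sqrt{st}}\right)$. It is a Gromov hyperbolic metric space. All sequences $\{(z_n,h_n)\}$ with $h_n\to\infty$ converge to infinity and are mutually equivalent in the sense below, so $\omega$ is well defined. Gromov hyperbolicity: in a metric space $(X,d_X)$, $(x|y)_o=\frac12(d_X(x,o)+d_X(y,o)-d_X(x,y))$; $X$ is Gromov $\delta$-hyperbolic if $(x|y)_o\ge\min\{(x|z)_o,(z|y)_o\}-\delta$ for all $x,y,z,o\in X$, and Gromov hyperbolic if this holds for some $\delta\ge0$. Gromov boundary: a sequence $\{x_i\}$ in $X$ converges to infinity if $(x_i|x_j)_o\to\infty$ as $i,j\to\infty$; two such sequences $\{x_i\},\{y_i\}$ are equivalent if $(x_i|y_i)_o\to\infty$ (independent of $o\in X$). $\partial_GX$ is the set of equivalence classes; $\{x_i\}\in\xi$ means that $\{x_i\}$ belongs to the class $\xi$. For $\xi\in\partial_GX$, $y\in X$: $(\xi|y)_o=(y|\xi)_o=\inf\{\liminf_i(x_i|y)_o:\{x_i\}\in\xi\}$. Busemann functions: for $\omega\in\partial_GX$ and $o\in X$, $b_{\omega,o}(x)=(\omega|o)_x-(\omega|x)_o$. $\mathcal B(\omega)$ is the set of functions $b:X\to\mathbb R$ for which there are $o'\in X$ and $c\in\mathbb R$ with $|b(x)-b_{\omega,o'}(x)|\le c$ for all $x\in X$. For $b\in\mathcal B(\omega)$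 and $x,y\in X$, $(x|y)_b=\frac12(b(x)+b(y)-d_X(x,y))$; for $\zeta,\xi\in\partial_GX\setminus\{\omega\}$, $(\zeta|\xi)_b=\inf\{\liminf_i(x_i|y_i)_b:\{x_i\}\in\zeta,\{y_i\}\in\xi\}$. Gromov boundary relative to $\omega$: fix $b\in\mathcal B(\omega)$. A sequence $\{x_n\}$ converges to infinity with respect to $\omega$ if $(x_m|x_n)_b\to\infty$ as $m,n\to\infty$; two such sequences are equivalent if $(x_n|y_n)_b\to\infty$. These notions do not depend on $b\in\mathcal B(\omega)$. $\partial_\omega X$ is the set of equivalence classes. It is known that a sequence converges to infinity with respect to $\omega$ if and only if it converges to some $\xi\in\partial_GX\setminus\{\omega\}$, and this gives an identification $\partial_\omega X=\partial_GX\setminus\{\omega\}$, which is used throughout. Visual metric: a metric $d$ on $\partial_\omega X$ is a visual metric based at $\omega$ with parameter $\varepsilon>0$ if for some (equivalently every) $b\in\mathcal B(\omega)$ there is a constant $C\ge1$ with $C^{-1}e^{-\varepsilon(\zeta|\xi)_b}\le d(\zeta,\xi)\le Ce^{-\varepsilon(\zeta|\xi)_b}$ for all $\zeta,\xi\in\partial_\omega X$ (with $e^{-\infty}=0$). *)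

theory Defs
  imports "HOL-Analysis.Analysis"
begin

(* A metric space is given by a carrier X and a distance function \<rho>, as in the locale
   Metric_space. Boundary points are equivalence classes of sequences, i.e. sets of
   sequences in X. *)

definition gromov_product :: "('a \<Rightarrow> 'a \<Rightarrow> real) \<Rightarrow> 'a \<Rightarrow> 'a \<Rightarrow> 'a \<Rightarrow> real" where
  "gromov_product \<rho> p x y = (\<rho> x p + \<rho> y p - \<rho> x y) / 2"

(* The base point p is immaterial: in a metric space, changing it alters the Gromov product
   by a bounded amount. *)
definition converges_to_infinity ::
    "'a set \<Rightarrow> ('a \<Rightarrow> 'a \<Rightarrow> real) \<Rightarrow> (nat \<Rightarrow> 'a) \<Rightarrow> bool" where
  "converges_to_infinity X \<rho> x \<longleftrightarrow> range x \<subseteq> X \<and>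
     (\<forall>p\<in>X. filterlim (\<lambda>(i, j). gromov_product \<rho> p (x i) (x j)) at_top
                (sequentially \<times>\<^sub>F sequentially))"

definition gromov_equiv ::
    "'a set \<Rightarrow> ('a \<Rightarrow> 'a \<Rightarrow> real) \<Rightarrow> ((nat \<Rightarrow> 'a) \<times> (nat \<Rightarrow> 'a)) set" where
  "gromov_equiv X \<rho> =
     {(x, y). converges_to_infinity X \<rho> x \<and> converges_to_infinity X \<rho> y \<and>
        (\<forall>p\<in>X. filterlim (\<lambda>i. gromov_product \<rho> p (x i) (y i)) at_top sequentially)}"

definition gromov_boundary ::
    "'a set \<Rightarrow> ('a \<Rightarrow> 'a \<Rightarrow> real) \<Rightarrow> (nat \<Rightarrow> 'a) set set" where
  "gromov_boundary X \<rho> = Collect (converges_to_infinity X \<rho>) // gromov_equiv X \<rho>"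

definition boundary_product ::
    "('a \<Rightarrow> 'a \<Rightarrow> real) \<Rightarrow> 'a \<Rightarrow> (nat \<Rightarrow> 'a) set \<Rightarrow> 'a \<Rightarrow> ereal" where
  "boundary_product \<rho> p \<xi> y =
     (INF x\<in>\<xi>. liminf (\<lambda>i. ereal (gromov_product \<rho> p (x i) y)))"

(* Both products are finite in a metric space: 0 \<le> (x|y)_p \<le> \<rho> y p. *)
definition busemann ::
    "('a \<Rightarrow> 'a \<Rightarrow> real) \<Rightarrow> (nat \<Rightarrow> 'a) set \<Rightarrow> 'a \<Rightarrow> 'a \<Rightarrow> real" where
  "busemann \<rho> \<omega> p x =
     real_of_ereal (boundary_product \<rho> x \<omega> p) - real_of_ereal (boundary_product \<rho> p \<omega> x)"

definition busemann_functions ::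
    "'a set \<Rightarrow> ('a \<Rightarrow> 'a \<Rightarrow> real) \<Rightarrow> (nat \<Rightarrow> 'a) set \<Rightarrow> ('a \<Rightarrow> real) set" where
  "busemann_functions X \<rho> \<omega> =
     {b. \<exists>p\<in>X. \<exists>c. \<forall>x\<in>X. \<bar>b x - busemann \<rho> \<omega> p x\<bar> \<le> c}"

definition busemann_product ::
    "('a \<Rightarrow> 'a \<Rightarrow> real) \<Rightarrow> ('a \<Rightarrow> real) \<Rightarrow> 'a \<Rightarrow> 'a \<Rightarrow> real" where
  "busemann_product \<rho> b x y = (b x + b y - \<rho> x y) / 2"

(* The choice of b is immaterial: any two elements of busemann_functions X \<rho> \<omega> differ by
   a bounded amount, for Gromov hyperbolic X, and that set is never empty if X is not. *)
definition converges_to_infinity_rel ::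
    "'a set \<Rightarrow> ('a \<Rightarrow> 'a \<Rightarrow> real) \<Rightarrow> (nat \<Rightarrow> 'a) set \<Rightarrow> (nat \<Rightarrow> 'a) \<Rightarrow> bool" where
  "converges_to_infinity_rel X \<rho> \<omega> x \<longleftrightarrow> range x \<subseteq> X \<and>
     (\<forall>b\<in>busemann_functions X \<rho> \<omega>.
        filterlim (\<lambda>(m, n). busemann_product \<rho> b (x m) (x n)) at_top
          (sequentially \<times>\<^sub>F sequentially))"

definition rel_equiv ::
    "'a set \<Rightarrow> ('a \<Rightarrow> 'a \<Rightarrow> real) \<Rightarrow> (nat \<Rightarrow> 'a) set
      \<Rightarrow> ((nat \<Rightarrow> 'a) \<times> (nat \<Rightarrow> 'a)) set" where
  "rel_equiv X \<rho> \<omega> =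
     {(x, y). converges_to_infinity_rel X \<rho> \<omega> x \<and> converges_to_infinity_rel X \<rho> \<omega> y \<and>
        (\<forall>b\<in>busemann_functions X \<rho> \<omega>.
           filterlim (\<lambda>n. busemann_product \<rho> b (x n) (y n)) at_top sequentially)}"

definition rel_boundary ::
    "'a set \<Rightarrow> ('a \<Rightarrow> 'a \<Rightarrow> real) \<Rightarrow> (nat \<Rightarrow> 'a) set \<Rightarrow> (nat \<Rightarrow> 'a) set set" where
  "rel_boundary X \<rho> \<omega> = Collect (converges_to_infinity_rel X \<rho> \<omega>) // rel_equiv X \<rho> \<omega>"

(* The identification of the boundary relative to \<omega> with the Gromov boundary minus \<omega>
   matches classes consisting of the same sequences, so this formula serves both. *)
definition busemann_boundary_product ::
    "('a \<Rightarrow> 'a \<Rightarrow> real) \<Rightarrow> ('a \<Rightarrow> real) \<Rightarrow> (nat \<Rightarrow> 'a) set \<Rightarrow> (nat \<Rightarrow> 'a) set \<Rightarrow> ereal" where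
  "busemann_boundary_product \<rho> b \<zeta> \<xi> =
     (INF (x, y)\<in>\<zeta> \<times> \<xi>. liminf (\<lambda>i. ereal (busemann_product \<rho> b (x i) (y i))))"

definition exp_ereal :: "ereal \<Rightarrow> ereal" where
  "exp_ereal t = (case t of ereal r \<Rightarrow> ereal (exp r) | PInfty \<Rightarrow> \<infinity> | MInfty \<Rightarrow> 0)"

definition visual_metric ::
    "'a set \<Rightarrow> ('a \<Rightarrow> 'a \<Rightarrow> real) \<Rightarrow> (nat \<Rightarrow> 'a) set \<Rightarrow> real
      \<Rightarrow> ((nat \<Rightarrow> 'a) set \<Rightarrow> (nat \<Rightarrow> 'a) set \<Rightarrow> real) \<Rightarrow> bool" where
  "visual_metric X \<rho> \<omega> \<epsilon> d \<longleftrightarrow>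
     Metric_space (rel_boundary X \<rho> \<omega>) d \<and> \<epsilon> > 0 \<and>
     (\<exists>b\<in>busemann_functions X \<rho> \<omega>. \<exists>C\<ge>1. \<forall>\<zeta>\<in>rel_boundary X \<rho> \<omega>. \<forall>\<xi>\<in>rel_boundary X \<rho> \<omega>.
        ereal (1 / C) * exp_ereal (- (ereal \<epsilon> * busemann_boundary_product \<rho> b \<zeta> \<xi>))
          \<le> ereal (d \<zeta> \<xi>) \<and>
        ereal (d \<zeta> \<xi>)
          \<le> ereal C * exp_ereal (- (ereal \<epsilon> * busemann_boundary_product \<rho> b \<zeta> \<xi>)))"

definition hyp_cone :: "'z set \<Rightarrow> ('z \<times> real) set" where
  "hyp_cone Z = Z \<times> {0<..}"

definition hyp_cone_dist ::
    "('z \<Rightarrow> 'z \<Rightarrow> real) \<Rightarrow> 'z \<times> real \<Rightarrow> 'z \<times> real \<Rightarrow> real" where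
  "hyp_cone_dist dZ = (\<lambda>(x, s) (y, t). 2 * ln ((dZ x y + max s t) / sqrt (s * t)))"

end

theory Submission
  imports Defs
begin

text \<open>
  Put \<open>g u v = d(x, y) + max s t\<close> for \<open>u = (x, s)\<close> and \<open>v = (y, t)\<close>. Then
  \<open>\<rho>(u, v) = 2 ln (g u v) - ln s - ln t\<close>, and \<open>g\<close> satisfies the triangle inequality, also at height
  \<open>0\<close>. Every sequence in \<open>\<omega>\<close> satisfies \<open>g (u n) p \<longlonglongrightarrow> \<infinity>\<close>, which gives the exact
  value \<open>ln h - ln t\<close> for the Busemann function based at a point of height \<open>h\<close>. Hence
  \<open>b (x, s) = - ln s\<close> is admissible, and for it \<open>(u|v)\<^sub>b = - ln (g u v)\<close>. A sequence therefore
  converges to infinity relative to \<open>\<omega>\<close> iff \<open>g (u m) (u n) \<longrightarrow> 0\<close>, that is, iff \<open>u\<close>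
  converges to a point \<open>(z, 0)\<close>; the class of \<open>u\<close> is determined by \<open>z\<close>, and the boundary product
  of the classes of \<open>z\<^sub>1\<close> and \<open>z\<^sub>2\<close> is \<open>- ln (d z\<^sub>1 z\<^sub>2)\<close>, so that the visual constant is \<open>1\<close>.
\<close>

section \<open>The gap function and sequences descending to height zero\<close>

definition cone_gap :: "('z \<Rightarrow> 'z \<Rightarrow> real) \<Rightarrow> 'z \<times> real \<Rightarrow> 'z \<times> real \<Rightarrow> real" where
  "cone_gap d u v = d (fst u) (fst v) + max (snd u) (snd v)"

text \<open>The pair \<open>(z, 0)\<close> lies outside the cone and stands for an ideal point. The
  gap to it controls the distance to \<open>z\<close> and the height at once. These sets turn out to
  be the points of the relative boundary.\<close>

definition cone_limits :: "'z set \<Rightarrow> ('z \<Rightarrow> 'z \<Rightarrow> real) \<Rightarrow> 'z \<Rightarrow> (nat \<Rightarrow> 'z \<times> real) set" where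
  "cone_limits Z d z = {u. range u \<subseteq> hyp_cone Z \<and> (\<lambda>n. cone_gap d (u n) (z, 0)) \<longlonglongrightarrow> 0}"

lemma mem_hyp_cone: "u \<in> hyp_cone Z \<longleftrightarrow> fst u \<in> Z \<and> snd u > 0"
  by (cases u) (auto simp: hyp_cone_def)

lemma filterlim_at_top_bounded_diff:
  fixes f g :: "'i \<Rightarrow> real"
  assumes "\<And>i. \<bar>f i - g i\<bar> \<le> c"
  shows "filterlim f at_top F \<longleftrightarrow> filterlim g at_top F"
proof -
  have *: "filterlim b at_top F"
    if "filterlim a at_top F" "\<And>i. \<bar>a i - b i\<bar> \<le> c" for a b :: "'i \<Rightarrow> real"
  proof -
    have "filterlim (\<lambda>i. - c + a i) at_top F"
      by (intro filterlim_tendsto_add_at_top[OF tendsto_const that(1)])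
    moreover have "- c + a i \<le> b i" for i
      using that(2)[of i] by linarith
    ultimately show ?thesis
      by (auto intro: filterlim_at_top_mono)
  qed
  show ?thesis
    using *[of f g] *[of g f] assms by (metis abs_minus_commute)
qed

lemma filterlim_minus_ln_at_top_iff:
  fixes f :: "'i \<Rightarrow> real"
  assumes pos: "\<And>i. f i > 0"
  shows "filterlim (\<lambda>i. - ln (f i)) at_top F \<longleftrightarrow> (f \<longlongrightarrow> 0) F"
proof
  assume "filterlim (\<lambda>i. - ln (f i)) at_top F"
  then have "filterlim (\<lambda>i. ln (f i)) at_bot F"
    by (simp add: filterlim_uminus_at_top)
  then have "((\<lambda>i. exp (ln (f i))) \<longlongrightarrow> 0) F"
    by (rule filterlim_compose[OF exp_at_bot])
  then show "(f \<longlongrightarrow> 0) F"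
    using pos by simp
next
  assume "(f \<longlongrightarrow> 0) F"
  then have "filterlim f (at_right 0) F"
    using pos by (simp add: filterlim_at order_less_imp_not_eq2)
  then have "filterlim (\<lambda>i. ln (f i)) at_bot F"
    by (rule filterlim_compose[OF ln_at_0])
  then show "filterlim (\<lambda>i. - ln (f i)) at_top F"
    by (simp add: filterlim_uminus_at_top)
qed

section \<open>The cone metric and its products in terms of the gap\<close>

context Metric_space
begin

lemma cone_gap_commute: "cone_gap d u v = cone_gap d v u"
  by (simp add: cone_gap_def commute max.commute)

lemma cone_gap_pos: "snd u > 0 \<Longrightarrow> cone_gap d u v > 0"
  unfolding cone_gap_def using nonneg[of "fst u" "fst v"] by linarith

text \<open>Heights are only required to be nonnegative, so that ideal points \<open>(z, 0)\<close>
  may occur as any of the three arguments.\<close>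

lemma cone_gap_triangle:
  assumes "fst u \<in> M" "fst v \<in> M" "fst w \<in> M" "snd u \<ge> 0" "snd v \<ge> 0" "snd w \<ge> 0"
  shows "cone_gap d u w \<le> cone_gap d u v + cone_gap d v w"
  unfolding cone_gap_def using triangle[OF assms(1-3)] assms(4-6) by linarith

lemma hyp_cone_dist_eq:
  assumes "snd u > 0" "snd v > 0"
  shows "hyp_cone_dist d u v = 2 * ln (cone_gap d u v) - ln (snd u) - ln (snd v)"
proof -
  have "hyp_cone_dist d u v = 2 * ln (cone_gap d u v / sqrt (snd u * snd v))"
    by (simp add: hyp_cone_dist_def cone_gap_def split_beta)
  also have "\<dots> = 2 * ln (cone_gap d u v) - ln (snd u) - ln (snd v)"
    using assms cone_gap_pos[of u v] by (simp add: ln_div ln_sqrt ln_mult add_divide_distrib)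
  finally show ?thesis .
qed

text \<open>The heights of \<open>u\<close> and \<open>v\<close> cancel; only that of the base point
  survives.\<close>

lemma gromov_product_cone:
  assumes "snd p > 0" "snd u > 0" "snd v > 0"
  shows "gromov_product (hyp_cone_dist d) p u v =
    ln (cone_gap d u p) + ln (cone_gap d v p) - ln (cone_gap d u v) - ln (snd p)"
  using assms by (simp add: gromov_product_def hyp_cone_dist_eq field_simps)

text \<open>The second summand averages the deviations of \<open>b\<close> from minus the logarithm
  of the height; for admissible \<open>b\<close> it is a bounded error.\<close>

lemma busemann_product_cone:
  assumes "snd u > 0" "snd v > 0"
  shows "busemann_product (hyp_cone_dist d) b u v =
    - ln (cone_gap d u v) + ((b u + ln (snd u)) + (b v + ln (snd v))) / 2"
  using assms by (simp add: busemann_product_def hyp_cone_dist_eq field_simps)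

section \<open>Sequences in the class \<omega> and Busemann functions\<close>

text \<open>Divergence of the gap to \<open>p\<close> passes from \<open>v\<close> to
  \<open>u\<close>: where \<open>u i\<close> stays near \<open>p\<close> while \<open>v i\<close> is
  far away, the gap between them is comparable to that from \<open>v i\<close> to \<open>p\<close>,
  which bounds the Gromov product.\<close>

lemma cone_gap_at_top:
  assumes p: "p \<in> hyp_cone M" and u: "range u \<subseteq> hyp_cone M" and v: "range v \<subseteq> hyp_cone M"
    and vp: "filterlim (\<lambda>i. cone_gap d (v i) p) at_top sequentially"
    and uv: "filterlim (\<lambda>i. gromov_product (hyp_cone_dist d) p (u i) (v i)) at_top sequentially"
  shows "filterlim (\<lambda>i. cone_gap d (u i) p) at_top sequentially"
  unfolding filterlim_at_top_gt[where c = 0]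
proof (intro allI impI)
  fix K :: real assume K: "K > 0"
  have "eventually (\<lambda>i. cone_gap d (v i) p \<ge> 2 * K) sequentially"
    using vp by (simp add: filterlim_at_top)
  \<comment> \<open>This threshold is exactly the upper bound for the product that
    \<open>cone_gap d (u i) p < K\<close> would force.\<close>
  moreover have "eventually (\<lambda>i. gromov_product (hyp_cone_dist d) p (u i) (v i)
      \<ge> ln K + ln 2 - ln (snd p)) sequentially"
    using uv by (simp add: filterlim_at_top)
  ultimately show "eventually (\<lambda>i. cone_gap d (u i) p \<ge> K) sequentially"
  proof eventually_elim
    case (elim i)
    have mem: "u i \<in> hyp_cone M" "v i \<in> hyp_cone M"
      using u v by auto
    show ?case
    proof (rule ccontr)
      assume less: "\<not> K \<le> cone_gap d (u i) p"
      have pos: "cone_gap d (u i) p > 0" "cone_gap d (v i) p > 0" "cone_gap d (u i) (v i) > 0"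
        using mem by (auto simp: mem_hyp_cone intro: cone_gap_pos)
      have "cone_gap d (v i) p \<le> cone_gap d (u i) (v i) + cone_gap d (u i) p"
        using cone_gap_triangle[of "v i" "u i" p] mem p
        by (simp add: mem_hyp_cone cone_gap_commute)
      \<comment> \<open>The gap from \<open>u i\<close> to \<open>p\<close> is less than
        \<open>K\<close>, hence less than half the left-hand side, and is absorbed.\<close>
      then have "cone_gap d (v i) p \<le> 2 * cone_gap d (u i) (v i)"
        using less elim(1) by linarith
      then have "ln (cone_gap d (v i) p) \<le> ln 2 + ln (cone_gap d (u i) (v i))"
        using pos by (metis ln_le_cancel_iff ln_mult_pos mult_pos_pos zero_less_numeral)
      moreover have "ln (cone_gap d (u i) p) < ln K"
        using less pos K by simp
      ultimately show False
        using elim(2) gromov_product_cone[of p "u i" "v i"] mem p by (simp add: mem_hyp_cone)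
    qed
  qed
qed

text \<open>The gaps from \<open>u i\<close> to \<open>p\<close> and to \<open>y\<close> differ by
  at most \<open>cone_gap d p y\<close>, so their ratio tends to 1 and its logarithm disappears from
  the product formula.\<close>

lemma gromov_product_tendsto_cone:
  assumes p: "p \<in> hyp_cone M" and y: "y \<in> hyp_cone M" and u: "range u \<subseteq> hyp_cone M"
    and lim: "filterlim (\<lambda>i. cone_gap d (u i) y) at_top sequentially"
  shows "(\<lambda>i. gromov_product (hyp_cone_dist d) p (u i) y)
    \<longlonglongrightarrow> ln (cone_gap d y p) - ln (snd p)"
proof -
  have mem: "u i \<in> hyp_cone M" for i
    using u by auto
  have pos: "cone_gap d (u i) q > 0" for i q
    using mem[of i] by (auto simp: mem_hyp_cone intro: cone_gap_pos)
  have bound: "norm (cone_gap d (u i) p - cone_gap d (u i) y) \<le> cone_gap d p y" for i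
    using cone_gap_triangle[of "u i" y p] cone_gap_triangle[of "u i" p y] mem[of i] p y
    by (simp add: mem_hyp_cone cone_gap_commute abs_le_iff)
  have "(\<lambda>i. (cone_gap d (u i) p - cone_gap d (u i) y) * inverse (cone_gap d (u i) y)) \<longlonglongrightarrow> 0"
  proof (rule Lim_null_comparison[OF always_eventually])
    show "\<forall>i. norm ((cone_gap d (u i) p - cone_gap d (u i) y) * inverse (cone_gap d (u i) y))
        \<le> cone_gap d p y * inverse (cone_gap d (u i) y)"
      unfolding norm_mult using bound pos by (simp add: abs_of_pos mult_right_mono less_imp_le)
    show "(\<lambda>i. cone_gap d p y * inverse (cone_gap d (u i) y)) \<longlonglongrightarrow> 0"
      by (intro tendsto_mult_right_zero tendsto_inverse_0_at_top lim)
  qed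
  then have "(\<lambda>i. 1 + (cone_gap d (u i) p - cone_gap d (u i) y) * inverse (cone_gap d (u i) y))
      \<longlonglongrightarrow> 1 + 0"
    by (intro tendsto_intros)
  moreover have "1 + (cone_gap d (u i) p - cone_gap d (u i) y) * inverse (cone_gap d (u i) y)
      = cone_gap d (u i) p / cone_gap d (u i) y" for i
    using pos[of i y] by (simp add: field_simps)
  ultimately have "(\<lambda>i. cone_gap d (u i) p / cone_gap d (u i) y) \<longlonglongrightarrow> 1"
    by simp
  then have "(\<lambda>i. ln (cone_gap d (u i) p / cone_gap d (u i) y)
      + (ln (cone_gap d y p) - ln (snd p))) \<longlonglongrightarrow> ln 1 + (ln (cone_gap d y p) - ln (snd p))"
    by (intro tendsto_intros) auto
  moreover have "gromov_product (hyp_cone_dist d) p (u i) y =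
      ln (cone_gap d (u i) p / cone_gap d (u i) y) + (ln (cone_gap d y p) - ln (snd p))" for i
    using gromov_product_cone[of p "u i" y] mem[of i] p y pos[of i p] pos[of i y]
    by (simp add: mem_hyp_cone ln_div)
  ultimately show ?thesis
    by simp
qed

text \<open>Every member of \<omega> is directly related to the representative \<open>w\<close>, so
  divergence passes from \<open>v\<close> to \<open>w\<close> and then from \<open>w\<close> to
  \<open>u\<close>.\<close>

lemma cone_gap_class_at_top:
  assumes \<omega>: "\<omega> \<in> gromov_boundary (hyp_cone M) (hyp_cone_dist d)"
    and v: "v \<in> \<omega>" "filterlim (\<lambda>n. snd (v n)) at_top sequentially"
    and u: "u \<in> \<omega>" and p: "p \<in> hyp_cone M"
  shows "filterlim (\<lambda>i. cone_gap d (u i) p) at_top sequentially"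
proof -
  obtain w where w: "\<omega> = gromov_equiv (hyp_cone M) (hyp_cone_dist d) `` {w}"
    using \<omega> by (auto simp: gromov_boundary_def elim: quotientE)
  have seqs: "range w \<subseteq> hyp_cone M" "range a \<subseteq> hyp_cone M"
    "filterlim (\<lambda>i. gromov_product (hyp_cone_dist d) p (w i) (a i)) at_top sequentially"
    if "a \<in> \<omega>" for a
    using that p by (auto simp: w gromov_equiv_def converges_to_infinity_def)
  have "filterlim (\<lambda>i. cone_gap d (v i) p) at_top sequentially"
    by (rule filterlim_at_top_mono[OF v(2)], rule always_eventually)
      (auto simp: cone_gap_def intro!: add_increasing)
  then have wp: "filterlim (\<lambda>i. cone_gap d (w i) p) at_top sequentially"
    using cone_gap_at_top[OF p] seqs[OF v(1)] by blast
  \<comment> \<open>Divergence is transferred from the second argument of the product to the first,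
    so the second transfer needs the arguments swapped.\<close>
  have "gromov_product (hyp_cone_dist d) p (w i) (u i)
      = gromov_product (hyp_cone_dist d) p (u i) (w i)" for i
  proof -
    have "w i \<in> hyp_cone M" "u i \<in> hyp_cone M"
      using seqs[OF u] by auto
    then show ?thesis
      using p by (simp add: gromov_product_cone mem_hyp_cone cone_gap_commute[of "w i" "u i"])
  qed
  then show ?thesis
    using cone_gap_at_top[OF p _ _ wp] seqs[OF u] by simp
qed

text \<open>The product with \<omega> is an infimum of equal limits. In the difference of the two
  products the logarithms of the gap between \<open>p\<close> and \<open>x\<close> cancel by
  symmetry.\<close>

lemma busemann_cone:
  assumes \<omega>: "\<omega> \<in> gromov_boundary (hyp_cone M) (hyp_cone_dist d)"
    and v: "v \<in> \<omega>" "filterlim (\<lambda>n. snd (v n)) at_top sequentially"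
    and p: "p \<in> hyp_cone M" and x: "x \<in> hyp_cone M"
  shows "busemann (hyp_cone_dist d) \<omega> p x = ln (snd p) - ln (snd x)"
proof -
  have range: "range u \<subseteq> hyp_cone M" if "u \<in> \<omega>" for u
    using that \<omega>
    by (auto simp: gromov_boundary_def gromov_equiv_def converges_to_infinity_def elim!: quotientE)
  have product: "boundary_product (hyp_cone_dist d) q \<omega> y = ereal (ln (cone_gap d y q) - ln (snd q))"
    if "q \<in> hyp_cone M" "y \<in> hyp_cone M" for q y
  proof -
    have "liminf (\<lambda>i. ereal (gromov_product (hyp_cone_dist d) q (u i) y))
        = ereal (ln (cone_gap d y q) - ln (snd q))" if "u \<in> \<omega>" for u
      using gromov_product_tendsto_cone[OF \<open>q \<in> _\<close> \<open>y \<in> _\<close> range[OF that]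
          cone_gap_class_at_top[OF \<omega> v that \<open>y \<in> _\<close>]]
      by (intro lim_imp_Liminf) auto
    then show ?thesis
      using v(1) by (auto simp: boundary_product_def cong: INF_cong intro!: INF_const)
  qed
  show ?thesis
    using product[OF p x] product[OF x p] by (simp add: busemann_def cone_gap_commute)
qed

text \<open>A change of base point only adds a constant, which the bound \<open>c\<close>
  absorbs.\<close>

lemma busemann_functions_cone:
  assumes "\<omega> \<in> gromov_boundary (hyp_cone M) (hyp_cone_dist d)"
    and "v \<in> \<omega>" "filterlim (\<lambda>n. snd (v n)) at_top sequentially" and p: "p \<in> hyp_cone M"
  shows "busemann_functions (hyp_cone M) (hyp_cone_dist d) \<omega>
    = {b. \<exists>c. \<forall>x\<in>hyp_cone M. \<bar>b x + ln (snd x)\<bar> \<le> c}" (is "?B = ?C")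
proof (intro equalityI subsetI)
  fix b assume "b \<in> ?B"
  then obtain q c where "q \<in> hyp_cone M"
    and "\<forall>x\<in>hyp_cone M. \<bar>b x - busemann (hyp_cone_dist d) \<omega> q x\<bar> \<le> c"
    by (auto simp: busemann_functions_def)
  then have "\<forall>x\<in>hyp_cone M. \<bar>b x + ln (snd x)\<bar> \<le> c + \<bar>ln (snd q)\<bar>"
    using busemann_cone[OF assms(1-3)] by fastforce
  then show "b \<in> ?C"
    by blast
next
  fix b assume "b \<in> ?C"
  then obtain c where "\<forall>x\<in>hyp_cone M. \<bar>b x + ln (snd x)\<bar> \<le> c"
    by blast
  then have "\<forall>x\<in>hyp_cone M. \<bar>b x - busemann (hyp_cone_dist d) \<omega> p x\<bar> \<le> c + \<bar>ln (snd p)\<bar>"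
    using busemann_cone[OF assms] by fastforce
  then show "b \<in> ?B"
    using p by (auto simp: busemann_functions_def)
qed

section \<open>Convergence relative to \<omega> as convergence of the gap\<close>

text \<open>The filter is arbitrary so that the lemma covers both the double limit defining
  convergence and the single limit defining equivalence.\<close>

lemma busemann_product_at_top_iff:
  assumes b: "\<forall>x\<in>hyp_cone M. \<bar>b x + ln (snd x)\<bar> \<le> c"
    and mem: "\<And>i. f i \<in> hyp_cone M" "\<And>i. g i \<in> hyp_cone M"
  shows "filterlim (\<lambda>i. busemann_product (hyp_cone_dist d) b (f i) (g i)) at_top F
    \<longleftrightarrow> ((\<lambda>i. cone_gap d (f i) (g i)) \<longlongrightarrow> 0) F"
proof -
  have "\<bar>busemann_product (hyp_cone_dist d) b (f i) (g i) - - ln (cone_gap d (f i) (g i))\<bar> \<le> c"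
    for i
  proof -
    have "\<bar>b (f i) + ln (snd (f i))\<bar> \<le> c" "\<bar>b (g i) + ln (snd (g i))\<bar> \<le> c"
      using b mem by auto
    then show ?thesis
      using busemann_product_cone[of "f i" "g i" b] mem[of i] by (simp add: mem_hyp_cone)
  qed
  then have "filterlim (\<lambda>i. busemann_product (hyp_cone_dist d) b (f i) (g i)) at_top F
      \<longleftrightarrow> filterlim (\<lambda>i. - ln (cone_gap d (f i) (g i))) at_top F"
    by (rule filterlim_at_top_bounded_diff)
  also have "\<dots> \<longleftrightarrow> ((\<lambda>i. cone_gap d (f i) (g i)) \<longlongrightarrow> 0) F"
    using mem by (intro filterlim_minus_ln_at_top_iff cone_gap_pos) (auto simp: mem_hyp_cone)
  finally show ?thesis .
qed

text \<open>This is the quadrilateral inequality for the gap, with the ideal points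
  \<open>(z, 0)\<close> and \<open>(z', 0)\<close> as two of the four vertices.\<close>

lemma cone_gap_tendsto:
  assumes "z \<in> M" "z' \<in> M" "\<And>i. f i \<in> hyp_cone M" "\<And>i. g i \<in> hyp_cone M"
    and f: "((\<lambda>i. cone_gap d (f i) (z, 0)) \<longlongrightarrow> 0) F"
    and g: "((\<lambda>i. cone_gap d (g i) (z', 0)) \<longlongrightarrow> 0) F"
  shows "((\<lambda>i. cone_gap d (f i) (g i)) \<longlongrightarrow> d z z') F"
proof -
  have bound: "norm (cone_gap d (f i) (g i) - d z z')
      \<le> cone_gap d (f i) (z, 0) + cone_gap d (g i) (z', 0)" for i
  proof -
    have base: "d z z' = cone_gap d (z, 0) (z', 0)"
      by (simp add: cone_gap_def)
    show ?thesis
      using assms(1,2) assms(3,4)[of i]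
        cone_gap_triangle[of "f i" "(z, 0)" "g i"] cone_gap_triangle[of "(z, 0)" "(z', 0)" "g i"]
        cone_gap_triangle[of "(z, 0)" "f i" "(z', 0)"] cone_gap_triangle[of "f i" "g i" "(z', 0)"]
        cone_gap_commute[of "(z, 0)" "f i"] cone_gap_commute[of "(z', 0)" "g i"]
      unfolding base real_norm_def by (simp add: mem_hyp_cone abs_le_iff)
  qed
  have "((\<lambda>i. cone_gap d (f i) (z, 0) + cone_gap d (g i) (z', 0)) \<longlongrightarrow> 0) F"
    using tendsto_add[OF f g] by simp
  then have "((\<lambda>i. cone_gap d (f i) (g i) - d z z') \<longlongrightarrow> 0) F"
    by (rule Lim_null_comparison[OF always_eventually[OF allI[OF bound]]])
  then show ?thesis
    by (rule LIM_zero_cancel)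
qed

text \<open>The witness descends vertically over \<open>z\<close>. \<open>Suc\<close> matters: at
  \<open>n = 0\<close> the value of \<open>1 / real n\<close> is 0, which is not a height of the
  cone.\<close>

lemma cone_limits_nonempty:
  assumes "z \<in> M"
  shows "(\<lambda>n. (z, 1 / real (Suc n))) \<in> cone_limits M d z"
proof -
  have "(\<lambda>n. cone_gap d (z, 1 / real (Suc n)) (z, 0)) = (\<lambda>n. 1 / real (Suc n))"
    using assms by (auto simp: cone_gap_def fun_eq_iff)
  then show ?thesis
    using assms LIMSEQ_Suc[OF lim_1_over_n]
    by (auto simp: cone_limits_def mem_hyp_cone)
qed

text \<open>The gap dominates the distance of the first coordinates, so these form a Cauchy sequence
  and completeness supplies \<open>z\<close>. The converse is \<open>cone_gap_tendsto\<close> with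
  both limits equal to \<open>z\<close>.\<close>

lemma cone_gap_Cauchy_iff:
  assumes complete: mcomplete and u: "range u \<subseteq> hyp_cone M"
  shows "((\<lambda>(m, n). cone_gap d (u m) (u n)) \<longlongrightarrow> 0) (sequentially \<times>\<^sub>F sequentially)
    \<longleftrightarrow> (\<exists>z\<in>M. u \<in> cone_limits M d z)"
proof
  assume lim: "((\<lambda>(m, n). cone_gap d (u m) (u n)) \<longlongrightarrow> 0) (sequentially \<times>\<^sub>F sequentially)"
  have mem: "fst (u n) \<in> M" "snd (u n) > 0" for n
    using u by (auto simp: mem_hyp_cone image_subset_iff)
  have small: "\<exists>N. \<forall>m\<ge>N. \<forall>n\<ge>N. cone_gap d (u m) (u n) < e" if "e > 0" for e
  proof -
    have "eventually (\<lambda>(m, n). cone_gap d (u m) (u n) < e) (sequentially \<times>\<^sub>F sequentially)"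
      using order_tendstoD(2)[OF lim that] by (simp add: split_beta')
    then show ?thesis
      by (auto simp: eventually_prod_sequentially)
  qed
  have "MCauchy (\<lambda>n. fst (u n))"
    unfolding MCauchy_def
  proof (intro conjI allI impI)
    fix e :: real assume "e > 0"
    then obtain N where "\<forall>m\<ge>N. \<forall>n\<ge>N. cone_gap d (u m) (u n) < e"
      using small by blast
    moreover have "d (fst (u m)) (fst (u n)) \<le> cone_gap d (u m) (u n)" for m n
      using mem(2)[of m] by (simp add: cone_gap_def)
    ultimately show "\<exists>N. \<forall>n n'. N \<le> n \<longrightarrow> N \<le> n' \<longrightarrow> d (fst (u n)) (fst (u n')) < e"
      by (meson order_le_less_trans)
  qed (use mem in auto)
  then obtain z where z: "limitin mtopology (\<lambda>n. fst (u n)) z sequentially"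
    using complete by (auto simp: mcomplete_def)
  then have "z \<in> M" and dz: "(\<lambda>n. d (fst (u n)) z) \<longlonglongrightarrow> 0"
    by (auto simp: limitin_metric_dist_null)
  have "(\<lambda>n. snd (u n)) \<longlonglongrightarrow> 0"
  proof (rule LIMSEQ_I)
    fix e :: real assume "e > 0"
    then obtain N where "\<forall>m\<ge>N. \<forall>n\<ge>N. cone_gap d (u m) (u n) < e"
      using small by blast
    \<comment> \<open>On the diagonal the distance vanishes and the gap is the height
      itself.\<close>
    then have "\<forall>n\<ge>N. cone_gap d (u n) (u n) < e"
      by blast
    then show "\<exists>N. \<forall>n\<ge>N. norm (snd (u n) - 0) < e"
      using mem by (auto simp: cone_gap_def abs_of_pos)
  qed
  then have "(\<lambda>n. d (fst (u n)) z + snd (u n)) \<longlonglongrightarrow> 0"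
    using tendsto_add[OF dz] by simp
  moreover have "cone_gap d (u n) (z, 0) = d (fst (u n)) z + snd (u n)" for n
    using mem(2)[of n] by (simp add: cone_gap_def)
  ultimately show "\<exists>z\<in>M. u \<in> cone_limits M d z"
    using u \<open>z \<in> M\<close> by (auto simp: cone_limits_def intro!: bexI[of _ z])
next
  assume "\<exists>z\<in>M. u \<in> cone_limits M d z"
  then obtain z where z: "z \<in> M" and lim: "(\<lambda>n. cone_gap d (u n) (z, 0)) \<longlonglongrightarrow> 0"
    by (auto simp: cone_limits_def)
  have "((\<lambda>x. cone_gap d (u (fst x)) (u (snd x))) \<longlongrightarrow> d z z) (sequentially \<times>\<^sub>F sequentially)"
    using u z
    by (intro cone_gap_tendsto filterlim_compose[OF lim] filterlim_fst filterlim_snd) auto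
  then show "((\<lambda>(m, n). cone_gap d (u m) (u n)) \<longlongrightarrow> 0) (sequentially \<times>\<^sub>F sequentially)"
    using z by (simp add: split_beta')
qed

lemma cone_limits_gap_iff:
  assumes "z \<in> M" "z' \<in> M" "u \<in> cone_limits M d z" "v \<in> cone_limits M d z'"
  shows "(\<lambda>n. cone_gap d (u n) (v n)) \<longlonglongrightarrow> 0 \<longleftrightarrow> z = z'"
proof -
  have "(\<lambda>n. cone_gap d (u n) (v n)) \<longlonglongrightarrow> d z z'"
    using assms by (intro cone_gap_tendsto) (auto simp: cone_limits_def)
  then show ?thesis
    using assms(1,2) zero[of z z'] LIMSEQ_unique by metis
qed

text \<open>For a common member \<open>u\<close>, the gap of \<open>u n\<close> to itself tends to
  \<open>d z z = 0\<close> and also to \<open>d z z'\<close>.\<close>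

lemma inj_on_cone_limits: "inj_on (cone_limits M d) M"
proof (rule inj_onI)
  fix z z' assume z: "z \<in> M" "z' \<in> M" and eq: "cone_limits M d z = cone_limits M d z'"
  define u where "u = (\<lambda>n. (z, 1 / real (Suc n)))"
  have u: "u \<in> cone_limits M d z"
    using cone_limits_nonempty[OF z(1)] by (simp add: u_def)
  then have "u \<in> cone_limits M d z'"
    by (simp add: eq)
  then show "z = z'"
    using cone_limits_gap_iff[OF z(1,1) u u] cone_limits_gap_iff[OF z u] by blast
qed

section \<open>The points of the relative boundary\<close>

lemma rel_boundary_cone:
  assumes complete: mcomplete and p: "p \<in> hyp_cone M"
    and \<omega>: "\<omega> \<in> gromov_boundary (hyp_cone M) (hyp_cone_dist d)"
    and v: "v \<in> \<omega>" "filterlim (\<lambda>n. snd (v n)) at_top sequentially"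
  shows "rel_boundary (hyp_cone M) (hyp_cone_dist d) \<omega> = cone_limits M d ` M"
proof -
  note B = busemann_functions_cone[OF \<omega> v p]
  \<comment> \<open>This choice has deviation zero. It also shows that the quantifier over Busemann
    functions is not vacuous, as the forward direction of \<open>all_iff\<close> requires.\<close>
  define b0 :: "'a \<times> real \<Rightarrow> real" where "b0 = (\<lambda>x. - ln (snd x))"
  have b0: "b0 \<in> busemann_functions (hyp_cone M) (hyp_cone_dist d) \<omega>"
    by (auto simp: B b0_def intro!: exI[of _ 0])
  have all_iff: "(\<forall>b\<in>busemann_functions (hyp_cone M) (hyp_cone_dist d) \<omega>.
        filterlim (\<lambda>i. busemann_product (hyp_cone_dist d) b (f i) (g i)) at_top F)
      \<longleftrightarrow> ((\<lambda>i. cone_gap d (f i) (g i)) \<longlongrightarrow> 0) F" (is "?L \<longleftrightarrow> ?R")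
    if mem: "\<And>i. f i \<in> hyp_cone M" "\<And>i. g i \<in> hyp_cone M"
    for f g :: "'i \<Rightarrow> 'a \<times> real" and F
  proof
    assume ?L
    with b0 have "filterlim (\<lambda>i. busemann_product (hyp_cone_dist d) b0 (f i) (g i)) at_top F"
      by blast
    then show ?R
      using busemann_product_at_top_iff[of b0 0 f g F] mem by (simp add: b0_def)
  next
    assume ?R
    then show ?L
      using busemann_product_at_top_iff[of _ _ f g F] mem unfolding B by blast
  qed
  have conv: "converges_to_infinity_rel (hyp_cone M) (hyp_cone_dist d) \<omega> u
      \<longleftrightarrow> (\<exists>z\<in>M. u \<in> cone_limits M d z)" for u
  proof (cases "range u \<subseteq> hyp_cone M")
    case True
    then have mem: "u i \<in> hyp_cone M" for i
      by auto
    \<comment> \<open>Composing \<open>u\<close> with the two projections turns the double limit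
      into an instance over the product filter.\<close>
    show ?thesis
      using all_iff[of "u \<circ> fst" "u \<circ> snd"] mem cone_gap_Cauchy_iff[OF complete True]
      by (simp add: converges_to_infinity_rel_def True split_beta')
  next
    case False
    then show ?thesis
      by (auto simp: converges_to_infinity_rel_def cone_limits_def)
  qed
  have equiv: "(u, u') \<in> rel_equiv (hyp_cone M) (hyp_cone_dist d) \<omega>
      \<longleftrightarrow> (\<exists>z\<in>M. u \<in> cone_limits M d z \<and> u' \<in> cone_limits M d z)" for u u'
  proof -
    have "(\<forall>b\<in>busemann_functions (hyp_cone M) (hyp_cone_dist d) \<omega>.
        filterlim (\<lambda>i. busemann_product (hyp_cone_dist d) b (u i) (u' i)) at_top sequentially)
      \<longleftrightarrow> z = z'"
      if z: "z \<in> M" "z' \<in> M" and u: "u \<in> cone_limits M d z" "u' \<in> cone_limits M d z'" for z z'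
    proof -
      have "u i \<in> hyp_cone M" "u' i \<in> hyp_cone M" for i
        using u by (auto simp: cone_limits_def)
      then show ?thesis
        using all_iff[of u u'] cone_limits_gap_iff[OF z u] by simp
    qed
    then show ?thesis
      unfolding rel_equiv_def by (auto simp: conv)
  qed
  have same: "z = z'" if "z \<in> M" "z' \<in> M" "u \<in> cone_limits M d z" "u \<in> cone_limits M d z'"
    for z z' u
    using that cone_limits_gap_iff[of z z u u] cone_limits_gap_iff[of z z' u u] by blast
  \<comment> \<open>Since a sequence has only one limit point by \<open>same\<close>, the
    existential witness in \<open>equiv\<close> must be the given \<open>z\<close>.\<close>
  have image: "rel_equiv (hyp_cone M) (hyp_cone_dist d) \<omega> `` {u} = cone_limits M d z"
    if "z \<in> M" "u \<in> cone_limits M d z" for u z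
    unfolding set_eq_iff Image_singleton_iff equiv using same[OF that(1) _ that(2)] that by metis
  show ?thesis
  proof (intro equalityI subsetI)
    fix \<zeta> assume "\<zeta> \<in> rel_boundary (hyp_cone M) (hyp_cone_dist d) \<omega>"
    then obtain u where "converges_to_infinity_rel (hyp_cone M) (hyp_cone_dist d) \<omega> u"
      and \<zeta>: "\<zeta> = rel_equiv (hyp_cone M) (hyp_cone_dist d) \<omega> `` {u}"
      unfolding rel_boundary_def by (blast elim: quotientE)
    then obtain z where "z \<in> M" "u \<in> cone_limits M d z"
      using conv by blast
    with \<zeta> show "\<zeta> \<in> cone_limits M d ` M"
      using image by blast
  next
    fix \<zeta> assume "\<zeta> \<in> cone_limits M d ` M"
    then obtain z where z: "z \<in> M" "\<zeta> = cone_limits M d z"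
      by blast
    obtain u where u: "u \<in> cone_limits M d z"
      using cone_limits_nonempty[OF z(1)] by blast
    have "converges_to_infinity_rel (hyp_cone M) (hyp_cone_dist d) \<omega> u"
      using u z(1) conv by blast
    then show "\<zeta> \<in> rel_boundary (hyp_cone M) (hyp_cone_dist d) \<omega>"
      using quotientI[of u] by (simp add: rel_boundary_def z(2) flip: image[OF z(1) u])
  qed
qed

section \<open>Boundary products and the visual metric\<close>

text \<open>All pairs of representatives give the same limit. For \<open>z = z'\<close> it is
  \<infinity>, and \<open>exp_ereal\<close> sends its negative to 0, the distance of a point to
  itself.\<close>

lemma exp_busemann_boundary_product_cone:
  assumes z: "z \<in> M" "z' \<in> M"
  shows "exp_ereal (- busemann_boundary_product (hyp_cone_dist d) (\<lambda>x. - ln (snd x))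
      (cone_limits M d z) (cone_limits M d z')) = ereal (d z z')"
proof -
  define l :: ereal where "l = (if z = z' then \<infinity> else ereal (- ln (d z z')))"
  have lim: "liminf (\<lambda>i. ereal (busemann_product (hyp_cone_dist d) (\<lambda>x. - ln (snd x)) (u i) (v i)))
      = l" if u: "u \<in> cone_limits M d z" and v: "v \<in> cone_limits M d z'" for u v
  proof -
    have mem: "u i \<in> hyp_cone M" "v i \<in> hyp_cone M" for i
      using u v by (auto simp: cone_limits_def)
    have gap: "(\<lambda>i. cone_gap d (u i) (v i)) \<longlonglongrightarrow> d z z'"
      using z u v mem by (intro cone_gap_tendsto) (auto simp: cone_limits_def)
    have "(\<lambda>i. ereal (- ln (cone_gap d (u i) (v i)))) \<longlonglongrightarrow> l"
    proof (cases "z = z'")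
      case True
      then have "filterlim (\<lambda>i. - ln (cone_gap d (u i) (v i))) at_top sequentially"
        using gap z mem
        by (subst filterlim_minus_ln_at_top_iff) (auto simp: mem_hyp_cone intro: cone_gap_pos)
      then show ?thesis
        using True by (simp add: l_def tendsto_PInfty_eq_at_top)
    next
      case False
      then have "(\<lambda>i. - ln (cone_gap d (u i) (v i))) \<longlonglongrightarrow> - ln (d z z')"
        using z by (intro tendsto_intros gap) auto
      then show ?thesis
        using False by (simp add: l_def)
    qed
    then show ?thesis
      using mem by (intro lim_imp_Liminf) (auto simp: busemann_product_cone mem_hyp_cone)
  qed
  \<comment> \<open>Over an empty index set the infimum would be \<infinity> instead of the common
    value \<open>l\<close>.\<close>
  have "cone_limits M d z \<times> cone_limits M d z' \<noteq> {}"
    using cone_limits_nonempty z by blast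
  then have "busemann_boundary_product (hyp_cone_dist d) (\<lambda>x. - ln (snd x))
      (cone_limits M d z) (cone_limits M d z') = l"
    unfolding busemann_boundary_product_def using lim
    by (intro INF_eq_const) (auto simp: split_beta)
  then show ?thesis
    using z by (auto simp: l_def exp_ereal_def)
qed

end

theorem theorem1p2:
  fixes Z :: "'z set" and dZ :: "'z \<Rightarrow> 'z \<Rightarrow> real"
    and \<omega> :: "(nat \<Rightarrow> 'z \<times> real) set"
  assumes "Metric_space Z dZ"
    and "Metric_space.mcomplete Z dZ"
    and "\<exists>x\<in>Z. \<exists>y\<in>Z. \<exists>z\<in>Z. x \<noteq> y \<and> y \<noteq> z \<and> x \<noteq> z"
    and "\<omega> \<in> gromov_boundary (hyp_cone Z) (hyp_cone_dist dZ)"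
    and "\<And>u. range u \<subseteq> hyp_cone Z \<Longrightarrow> filterlim (\<lambda>n. snd (u n)) at_top sequentially \<Longrightarrow> u \<in> \<omega>"
  shows "\<exists>\<psi>. bij_betw \<psi> Z (rel_boundary (hyp_cone Z) (hyp_cone_dist dZ) \<omega>) \<and>
           (\<exists>d. (\<forall>z1\<in>Z. \<forall>z2\<in>Z. d (\<psi> z1) (\<psi> z2) = dZ z1 z2) \<and>
                visual_metric (hyp_cone Z) (hyp_cone_dist dZ) \<omega> 1 d)"
proof -
  interpret Metric_space Z dZ
    by (rule assms(1))
  obtain z0 where "z0 \<in> Z"
    using assms(3) by blast
  \<comment> \<open>A vertical ascending sequence provides the member of \<omega> with unbounded
    heights that the description of Busemann functions starts from.\<close>
  define v where "v = (\<lambda>n. (z0, real (Suc n)))"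
  have lim: "filterlim (\<lambda>n. snd (v n)) at_top sequentially"
    unfolding v_def snd_conv
    by (rule filterlim_compose[OF filterlim_real_sequentially filterlim_Suc])
  have "v \<in> \<omega>"
    using \<open>z0 \<in> Z\<close> by (intro assms(5) lim) (auto simp: v_def mem_hyp_cone)
  have p: "(z0, 1) \<in> hyp_cone Z"
    using \<open>z0 \<in> Z\<close> by (simp add: mem_hyp_cone)
  let ?\<psi> = "cone_limits Z dZ" and ?b = "\<lambda>x. - ln (snd x)"
  note boundary = rel_boundary_cone[OF assms(2) p assms(4) \<open>v \<in> \<omega>\<close> lim]
  define d where "d = (\<lambda>\<zeta> \<xi>. dZ (inv_into Z ?\<psi> \<zeta>) (inv_into Z ?\<psi> \<xi>))"
  have d: "d (?\<psi> z1) (?\<psi> z2) = dZ z1 z2" if "z1 \<in> Z" "z2 \<in> Z" for z1 z2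
    using that inj_on_cone_limits by (simp add: d_def)
  have metric: "Metric_space (?\<psi> ` Z) d"
  proof
    \<comment> \<open>\<open>Metric_space\<close> demands nonnegativity and symmetry for all
      arguments, even outside the carrier. Both hold globally for \<open>dZ\<close> and so for its
      composition with \<open>inv_into\<close>.\<close>
    show "0 \<le> d \<zeta> \<xi>" "d \<zeta> \<xi> = d \<xi> \<zeta>" for \<zeta> \<xi>
      by (simp_all add: d_def commute)
  qed (auto simp: d triangle inj_on_eq_iff[OF inj_on_cone_limits])
  have "?b \<in> busemann_functions (hyp_cone Z) (hyp_cone_dist dZ) \<omega>"
    using busemann_functions_cone[OF assms(4) \<open>v \<in> \<omega>\<close> lim p] by (auto intro!: exI[of _ 0])
  moreover have "exp_ereal (- (ereal 1 * busemann_boundary_product (hyp_cone_dist dZ) ?b \<zeta> \<xi>))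
      = ereal (d \<zeta> \<xi>)" if "\<zeta> \<in> ?\<psi> ` Z" "\<xi> \<in> ?\<psi> ` Z" for \<zeta> \<xi>
    using that d exp_busemann_boundary_product_cone by (auto simp flip: one_ereal_def)
  ultimately have "visual_metric (hyp_cone Z) (hyp_cone_dist dZ) \<omega> 1 d"
    unfolding visual_metric_def boundary using metric
    by (intro conjI bexI[of _ ?b] exI[of _ 1]) (auto simp flip: one_ereal_def)
  moreover have "bij_betw ?\<psi> Z (rel_boundary (hyp_cone Z) (hyp_cone_dist dZ) \<omega>)"
    using inj_on_cone_limits by (simp add: bij_betw_def boundary)
  ultimately show ?thesis
    using d by blast
qed

end
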